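(* Let $n,k$ be integers such that $k\le n/2$, and let $M$ belong to the Bose--Mesner algebra of the $(n,k)$ Johnson association scheme. The bases $\mathcal{Y}_{n,0},\dots,\mathcal{Y}_{n,k}$ span the eigenspaces of $M$.
   Context: The slice is $\binom{[n]}{k}=\{(x_1,\dots,x_n)\in\{0,1\}^n:\sum_i x_i=k\}$, identified with the set of $k$-element subsets of $[n]=\{1,\dots,n\}$. A square matrix $M$ indexed by $\binom{[n]}{k}$ belongs to the Bose--Mesner algebra of the $(n,k)$ Johnson association scheme if $M_{S,T}$ depends only on $|S\cap T|$; it is regarded as a linear operator on functions $\binom{[n]}{k}\to\mathbb{R}$. For an integer $0\le d\le n/2$, $\mathcal{S}_{n,d}$ is the set of sequences $S=s_1,\dots,s_d$ of distinct elements of $[n]$. For disjoint $A,B\in\mathcal{S}_{n,d}$ (no common elements), let $\chi_{A,B}=\prod_{i=1}^d(x_{a_i}-x_{b_i})$, and write $A<B$ if $a_i<b_i$ for all $i\in\{1,\dots,d\}$ (the relation is defined for disjoint sequences; $A$ need not be increasing). A top set of length $d$ is an increasing sequence $B\in\mathcal{S}_{n,d}$ such that $A<B$ for some $A\in\mathcal{S}_{n,d}$ disjoint from $B$. $\mathcal{B}_{n,d}$ is the set of top sets of length $d$. For $B\in\mathcal{B}_{n,d}$, define $$\chi_B=\sum_{A\in\mathcal{S}_{n,d}:\ A<B}\chi_{A,B},$$ the sum being over sequences $A$ disjoint from $B$ (so $\chi_\emptyset=1$), and let $\mathcal{Y}_{n,d}=\{\chi_B:B\in\mathcal{B}_{n,d}\}$.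 Polynomials in $x_1,\dots,x_n$ are viewed as functions on the slice by restriction. *)

theory Defs
  imports Complex_Main "HOL-Library.Function_Algebras" "HOL-Library.Indicator_Function"
begin

text \<open>
  Points of the slice are represented by the \<open>k\<close>-element subsets of \<open>{1..n}\<close>.  A real function on
  the slice is a function on \<open>nat set\<close> vanishing outside the slice; these functions form a
  subspace of the space of all functions \<open>nat set \<Rightarrow> real\<close> with the pointwise operations.
\<close>

definition fun_scale :: "real \<Rightarrow> (nat set \<Rightarrow> real) \<Rightarrow> nat set \<Rightarrow> real" where
  "fun_scale c f = (\<lambda>S. c * f S)"

global_interpretation fun_vs: vector_space fun_scale
  by unfold_locales (auto simp: fun_scale_def fun_eq_iff algebra_simps)

definition slice :: "nat \<Rightarrow> nat \<Rightarrow> nat set set" where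
  "slice n k = {S. S \<subseteq> {1..n} \<and> card S = k}"

definition slice_functions :: "nat \<Rightarrow> nat \<Rightarrow> (nat set \<Rightarrow> real) set" where
  "slice_functions n k = {f. \<forall>S. S \<notin> slice n k \<longrightarrow> f S = 0}"

text \<open>
  Only the entries of a matrix with both indices in the slice matter, here and in its action on
  functions.
\<close>

definition bose_mesner :: "nat \<Rightarrow> nat \<Rightarrow> (nat set \<Rightarrow> nat set \<Rightarrow> real) \<Rightarrow> bool" where
  "bose_mesner n k M \<longleftrightarrow>
     (\<exists>\<phi> :: nat \<Rightarrow> real. \<forall>S \<in> slice n k. \<forall>T \<in> slice n k. M S T = \<phi> (card (S \<inter> T)))"

definition mat_apply ::
    "nat \<Rightarrow> nat \<Rightarrow> (nat set \<Rightarrow> nat set \<Rightarrow> real) \<Rightarrow> (nat set \<Rightarrow> real) \<Rightarrow> nat set \<Rightarrow> real" where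
  "mat_apply n k M f = (\<lambda>S. if S \<in> slice n k then \<Sum>T\<in>slice n k. M S T * f T else 0)"

definition eigenspace ::
    "nat \<Rightarrow> nat \<Rightarrow> (nat set \<Rightarrow> nat set \<Rightarrow> real) \<Rightarrow> real \<Rightarrow> (nat set \<Rightarrow> real) set" where
  "eigenspace n k M \<mu> = {f \<in> slice_functions n k. mat_apply n k M f = fun_scale \<mu> f}"

definition seqs :: "nat \<Rightarrow> nat \<Rightarrow> nat list set" where
  "seqs n d = {A. length A = d \<and> distinct A \<and> set A \<subseteq> {1..n}}"

definition seq_less :: "nat list \<Rightarrow> nat list \<Rightarrow> bool" where
  "seq_less A B \<longleftrightarrow> set A \<inter> set B = {} \<and> list_all2 (<) A B"

definition top_sets :: "nat \<Rightarrow> nat \<Rightarrow> nat list set" where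
  "top_sets n d = {B \<in> seqs n d. sorted_wrt (<) B \<and> (\<exists>A \<in> seqs n d. seq_less A B)}"

text \<open>Polynomials in \<open>x\<^sub>1, \<dots>, x\<^sub>n\<close> are given by their values at points \<open>x :: nat \<Rightarrow> real\<close>.\<close>

definition chi_pair :: "nat list \<Rightarrow> nat list \<Rightarrow> (nat \<Rightarrow> real) \<Rightarrow> real" where
  "chi_pair A B x = (\<Prod>i<length B. x (A ! i) - x (B ! i))"

definition chi_top :: "nat \<Rightarrow> nat list \<Rightarrow> (nat \<Rightarrow> real) \<Rightarrow> real" where
  "chi_top n B x = (\<Sum>A\<in>{A \<in> seqs n (length B). seq_less A B}. chi_pair A B x)"

text \<open>The set \<open>S\<close> stands for the 0/1-vector \<open>indicator S\<close>.\<close>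

definition slice_restrict :: "nat \<Rightarrow> nat \<Rightarrow> ((nat \<Rightarrow> real) \<Rightarrow> real) \<Rightarrow> nat set \<Rightarrow> real" where
  "slice_restrict n k P = (\<lambda>S. if S \<in> slice n k then P (indicator S) else 0)"

definition Y_basis :: "nat \<Rightarrow> nat \<Rightarrow> nat \<Rightarrow> (nat set \<Rightarrow> real) set" where
  "Y_basis n k d = (\<lambda>B. slice_restrict n k (chi_top n B)) ` top_sets n d"

end

theory Submission
  imports Defs "HOL-Combinatorics.Transposition"
begin

text \<open>
  Transposing \<open>a\<^sub>i\<close> and \<open>b\<^sub>i\<close> negates \<open>\<chi>\<^bsub>A,B\<^esub>\<close>, and \<open>M\<close> commutes with the symmetric group.
  Hence \<open>M \<chi>\<^bsub>A,B\<^esub>\<close> vanishes at every \<open>S\<close> that does not separate all pairs \<open>a\<^sub>i, b\<^sub>i\<close>, and by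
  transitivity it is a multiple of \<open>\<chi>\<^bsub>A,B\<^esub>\<close>, with a factor depending only on the length \<open>d\<close>.
  The functionals \<open>f \<mapsto> \<Sum>T \<supseteq> B. f T\<close> show that all \<open>\<chi>\<^sub>B\<close> of lengths at most \<open>k\<close> are jointly
  independent.  By the ballot recursion there are \<open>n choose k\<close> of them, so they form a basis of
  eigenvectors of the functions on the slice.
\<close>

section \<open>Symmetries of the slice\<close>

lemma finite_slice: "finite (slice n k)"
  unfolding slice_def by (rule finite_subset[of _ "Pow {1..n}"]) auto

lemma seqs_nth: "A \<in> seqs n d \<Longrightarrow> i < d \<Longrightarrow> A ! i \<in> {1..n}"
  unfolding seqs_def using nth_mem by blast

lemma bij_betw_image_slice:
  assumes "bij_betw p {1..n} {1..n}"
  shows "bij_betw ((`) p) (slice n k) (slice n k)"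
proof -
  have inj: "inj_on p {1..n}" and im: "p ` {1..n} = {1..n}"
    using assms by (auto simp: bij_betw_def)
  have injS: "inj_on ((`) p) (slice n k)"
    by (rule inj_onI) (auto simp: slice_def inj_on_image_eq_iff[OF inj])
  have sub: "(`) p ` slice n k \<subseteq> slice n k"
  proof
    fix U assume "U \<in> (`) p ` slice n k"
    then obtain T where T: "T \<subseteq> {1..n}" "card T = k" "U = p ` T" by (auto simp: slice_def)
    have "card U = k" using T card_image[OF inj_on_subset[OF inj T(1)]] by simp
    moreover have "U \<subseteq> {1..n}" using T im by blast
    ultimately show "U \<in> slice n k" by (simp add: slice_def)
  qed
  show ?thesis
    unfolding bij_betw_def using injS endo_inj_surj[OF finite_slice sub injS] by blast
qed

lemma bij_betw_transpose:
  assumes "a \<in> X" "b \<in> X"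
  shows "bij_betw (transpose a b) X X"
  by (rule bij_betw_byWitness[where f' = "transpose a b"]) (use assms in \<open>auto simp: transpose_def\<close>)

lemma indicator_transpose_image:
  "indicator (transpose a b ` T) x = (indicator T (transpose a b x) :: real)"
proof -
  have "x \<in> transpose a b ` T \<longleftrightarrow> transpose a b x \<in> T"
    by (metis image_iff transpose_involutory)
  then show ?thesis by (simp add: indicator_def)
qed

text \<open>Since all entries of \<open>A\<close> and \<open>B\<close> are pairwise different, the
  transposition fixes every entry except \<open>A ! i\<close> and \<open>B ! i\<close>. So only the
  factor with index \<open>i\<close> changes, and it changes sign.\<close>

lemma chi_pair_transpose:
  assumes "length A = length B" "distinct A" "distinct B" "set A \<inter> set B = {}" "i < length B"
  shows "chi_pair A B (indicator (transpose (A ! i) (B ! i) ` T)) = - chi_pair A B (indicator T)"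
proof -
  let ?t = "transpose (A ! i) (B ! i)"
  have "A ! j \<noteq> B ! l" if "j < length B" "l < length B" for j l
    using assms(1,4) that by (metis disjoint_iff nth_mem)
  then have *: "?t (A ! j) = A ! j" "?t (B ! j) = B ! j" if "j < length B" "j \<noteq> i" for j
    using that assms by (metis nth_eq_iff_index_eq transpose_apply_other)+
  have "chi_pair A B (indicator (?t ` T)) =
      (\<Prod>j<length B. indicator T (?t (A ! j)) - indicator T (?t (B ! j)))"
    by (simp add: chi_pair_def indicator_transpose_image)
  also have "\<dots> = (indicator T (B ! i) - indicator T (A ! i)) *
      (\<Prod>j\<in>{..<length B}-{i}. indicator T (A ! j) - indicator T (B ! j))"
    using assms(5) * by (subst prod.remove[of _ i]) (auto intro!: prod.cong)
  also have "\<dots> = - chi_pair A B (indicator T)"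
    unfolding chi_pair_def using assms(5) by (subst (2) prod.remove[of _ i]) (auto simp: algebra_simps)
  finally show ?thesis .
qed

text \<open>The weight is symmetric and \<open>chi_pair A B\<close> antisymmetric under the
  transposition, so reindexing the sum by it yields its own negative. The weight will be a row of
  the matrix when eigenvectors are computed, and the condition \<open>E \<subseteq> T\<close> when
  independence is proved.\<close>

lemma sum_chi_pair_eq_0:
  fixes W :: "nat set \<Rightarrow> real"
  assumes A: "A \<in> seqs n d" and B: "B \<in> seqs n d" and disj: "set A \<inter> set B = {}" and i: "i < d"
    and W: "\<And>T. W (transpose (A ! i) (B ! i) ` T) = W T"
  shows "(\<Sum>T\<in>slice n k. W T * chi_pair A B (indicator T)) = 0"
proof -
  let ?t = "transpose (A ! i) (B ! i)"
  have "A ! i \<in> {1..n}" "B ! i \<in> {1..n}"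
    using A B i by (auto dest: seqs_nth)
  then have "bij_betw ((`) ?t) (slice n k) (slice n k)"
    by (intro bij_betw_image_slice bij_betw_transpose)
  then have "(\<Sum>T\<in>slice n k. W T * chi_pair A B (indicator T)) =
      (\<Sum>T\<in>slice n k. W (?t ` T) * chi_pair A B (indicator (?t ` T)))"
    by (rule sum.reindex_bij_betw[symmetric])
  also have "\<dots> = - (\<Sum>T\<in>slice n k. W T * chi_pair A B (indicator T))"
    using A B disj i by (simp add: W chi_pair_transpose seqs_def sum_negf)
  finally show ?thesis by simp
qed

section \<open>Eigenvectors\<close>

text \<open>Equivariance of the matrix action: a relabelling \<open>p\<close> of
  \<open>{1..n}\<close> permutes the slice and preserves the sizes of intersections. Outside
  \<open>{1..n}\<close> nothing is known about \<open>p\<close>, whence the range conditions on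
  \<open>S\<close>, \<open>A\<close> and \<open>B\<close>.\<close>

lemma sum_chi_pair_image:
  fixes \<phi> :: "nat \<Rightarrow> real"
  assumes p: "bij_betw p {1..n} {1..n}" and S: "S \<subseteq> {1..n}"
    and A: "A \<in> seqs n d" and B: "B \<in> seqs n d"
  shows "(\<Sum>T\<in>slice n k. \<phi> (card (p ` S \<inter> T)) * chi_pair (map p A) (map p B) (indicator T)) =
    (\<Sum>T\<in>slice n k. \<phi> (card (S \<inter> T)) * chi_pair A B (indicator T))" (is "?l = ?r")
proof -
  have inj: "inj_on p {1..n}" using p by (auto simp: bij_betw_def)
  have "?l = (\<Sum>T\<in>slice n k. \<phi> (card (p ` S \<inter> p ` T)) *
      chi_pair (map p A) (map p B) (indicator (p ` T)))"
    by (rule sum.reindex_bij_betw[OF bij_betw_image_slice[OF p], symmetric])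
  also have "\<dots> = ?r"
  proof (rule sum.cong[OF refl])
    fix T assume "T \<in> slice n k"
    then have T: "T \<subseteq> {1..n}" by (simp add: slice_def)
    have "card (p ` S \<inter> p ` T) = card (S \<inter> T)"
      using inj_on_image_Int[OF inj S T] card_image[OF inj_on_subset[OF inj, of "S \<inter> T"]] S by auto
    moreover have ind: "(indicator (p ` T) (p x) :: real) = indicator T x" if "x \<in> {1..n}" for x
      using inj_on_image_mem_iff[OF inj that T] by (simp add: indicator_def)
    have "A ! i \<in> {1..n}" "B ! i \<in> {1..n}" if "i < d" for i
      using A B that by (auto dest: seqs_nth)
    then have "chi_pair (map p A) (map p B) (indicator (p ` T)) = chi_pair A B (indicator T)"
      using A B ind by (auto simp: chi_pair_def seqs_def intro!: prod.cong)
    ultimately show "\<phi> (card (p ` S \<inter> p ` T)) * chi_pair (map p A) (map p B) (indicator (p ` T)) =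
        \<phi> (card (S \<inter> T)) * chi_pair A B (indicator T)" by simp
  qed
  finally show ?thesis .
qed

lemma map_onto_list:
  assumes "distinct xs" "length xs = length ys"
  obtains f where "map f xs = ys"
proof
  show "map (\<lambda>x. the (map_of (zip xs ys) x)) xs = ys"
    using assms by (intro nth_equalityI) (auto simp: map_of_zip_nth)
qed

text \<open>Transitivity of the symmetric group on triples with \<open>A\<close> inside
  \<open>S\<close> and \<open>B\<close> outside. List \<open>{1..n}\<close> in the blocks
  \<open>A\<close>, rest of \<open>S\<close>, \<open>B\<close>, remainder. The blocks have the same
  lengths for both triples, so matching the two lists entry by entry gives \<open>p\<close>.\<close>

lemma bij_betw_positive_triples:
  assumes "A \<in> seqs n d" "B \<in> seqs n d" "set A \<inter> set B = {}"
    and "S \<in> slice n k" "set A \<subseteq> S" "set B \<inter> S = {}"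
    and "A' \<in> seqs n d" "B' \<in> seqs n d" "set A' \<inter> set B' = {}"
    and "S' \<in> slice n k" "set A' \<subseteq> S'" "set B' \<inter> S' = {}"
  obtains p where "bij_betw p {1..n} {1..n}" "map p A = A'" "map p B = B'" "p ` S = S'"
proof -
  define R where "R A S = sorted_list_of_set (S - set A)" for A and S :: "nat set"
  define L where "L A B S = A @ R A S @ B @ sorted_list_of_set ({1..n} - S - set B)"
    for A B and S :: "nat set"
  have *: "distinct (L A B S) \<and> set (L A B S) = {1..n} \<and> length (R A S) = k - d \<and> set (A @ R A S) = S"
    if "A \<in> seqs n d" "B \<in> seqs n d" "set A \<inter> set B = {}"
      "S \<in> slice n k" "set A \<subseteq> S" "set B \<inter> S = {}" for A B S
  proof -
    have f: "finite S" using that(4) by (auto simp: slice_def intro: finite_subset)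
    have "card (S - set A) = k - d"
      using that f by (subst card_Diff_subset) (auto simp: slice_def seqs_def distinct_card)
    then show ?thesis using that f by (auto simp: L_def R_def slice_def seqs_def)
  qed
  note 1 = *[OF assms(1-6)] and 2 = *[OF assms(7-12)]
  have len: "length (L A B S) = n" "length (L A' B' S') = n"
    using 1 2 by (metis card_atLeastAtMost diff_Suc_1 distinct_card)+
  obtain p where p: "map p (L A B S) = L A' B' S'"
    using map_onto_list[of "L A B S" "L A' B' S'"] 1 len by metis
  have im: "p ` {1..n} = {1..n}" using p 1 2 by (metis list.set_map)
  then have "bij_betw p {1..n} {1..n}"
    by (simp add: bij_betw_def eq_card_imp_inj_on)
  moreover have "map p A = A' \<and> map p (R A S) = R A' S' \<and> map p B = B'"
    using p 1 2 assms(1,2,7,8) by (simp add: L_def seqs_def)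
  moreover from this have "map p (A @ R A S) = A' @ R A' S'" by simp
  then have "p ` S = S'" using 1 2 by (metis list.set_map)
  ultimately show thesis using that by blast
qed

text \<open>The factor \<open>c\<close> is fixed before \<open>A\<close>, \<open>B\<close> and
  \<open>S\<close>, so it is common to all pairs of length \<open>d\<close>. It is the value of the
  sum at a positive triple (\<open>A\<close> inside \<open>S\<close>, \<open>B\<close> outside),
  where \<open>chi_pair A B (indicator S)\<close> is 1. Every other point is reduced to this case,
  or both sides vanish there.\<close>

lemma chi_pair_eigenvector:
  fixes \<phi> :: "nat \<Rightarrow> real"
  obtains c where "\<And>A B S. A \<in> seqs n d \<Longrightarrow> B \<in> seqs n d \<Longrightarrow> set A \<inter> set B = {} \<Longrightarrow> S \<in> slice n k \<Longrightarrow>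
    (\<Sum>T\<in>slice n k. \<phi> (card (S \<inter> T)) * chi_pair A B (indicator T)) = c * chi_pair A B (indicator S)"
proof -
  define F where "F A B S = (\<Sum>T\<in>slice n k. \<phi> (card (S \<inter> T)) * chi_pair A B (indicator T))" for A B S
  define pos where "pos A B S \<longleftrightarrow> A \<in> seqs n d \<and> B \<in> seqs n d \<and> set A \<inter> set B = {} \<and>
    S \<in> slice n k \<and> set A \<subseteq> S \<and> set B \<inter> S = {}" for A B S
  have same: "F A' B' S' = F A B S" if "pos A B S" "pos A' B' S'" for A B S A' B' S'
  proof -
    obtain p where p: "bij_betw p {1..n} {1..n}" "map p A = A'" "map p B = B'" "p ` S = S'"
      using bij_betw_positive_triples[of A n d B S k A' B' S'] \<open>pos A B S\<close> \<open>pos A' B' S'\<close>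
      unfolding pos_def by metis
    show ?thesis
      using sum_chi_pair_image[OF p(1), of S A d B \<phi> k] \<open>pos A B S\<close>
      unfolding F_def p(2-4) by (simp add: pos_def slice_def)
  qed
  \<comment> \<open>If no positive triple exists, \<open>c\<close> is arbitrary; the second case
    below then cannot occur, since it constructs one.\<close>
  obtain c where c: "F A B S = c" if "pos A B S" for A B S
    using same by metis
  have "F A B S = c * chi_pair A B (indicator S)"
    if A: "A \<in> seqs n d" and B: "B \<in> seqs n d" and disj: "set A \<inter> set B = {}" and S: "S \<in> slice n k"
    for A B S
  \<comment> \<open>If \<open>S\<close> fails to separate the pair with index \<open>i\<close>, it
    is invariant under transposing that pair. The row of \<open>S\<close> is then a symmetric
    weight, and on the right the factor with index \<open>i\<close> is zero.\<close>
  proof (cases "\<exists>i<d. A ! i \<in> S \<longleftrightarrow> B ! i \<in> S")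
    case True
    then obtain i where i: "i < d" "A ! i \<in> S \<longleftrightarrow> B ! i \<in> S" by blast
    let ?t = "transpose (A ! i) (B ! i)"
    have S_inv: "?t ` S = S" using i(2) by (auto simp: transpose_image_eq)
    have "card (S \<inter> ?t ` T) = card (S \<inter> T)" for T
    proof -
      have "S \<inter> ?t ` T = ?t ` (S \<inter> T)"
        using S_inv by (metis image_Int inj_transpose)
      then show ?thesis by (simp add: card_image)
    qed
    then have "F A B S = 0"
      unfolding F_def by (intro sum_chi_pair_eq_0[OF A B disj i(1)]) simp
    moreover have "chi_pair A B (indicator S) = 0"
      unfolding chi_pair_def using i B by (intro prod_zero) (auto simp: seqs_def indicator_def)
    ultimately show ?thesis by simp
  next
    case False
    \<comment> \<open>Reorient each pair so that its entry in \<open>S\<close> comes first. Every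
      swap contributes a factor -1, and the product of these signs is exactly
      \<open>chi_pair A B (indicator S)\<close>.\<close>
    define A' where "A' = map (\<lambda>i. if A ! i \<in> S then A ! i else B ! i) [0..<d]"
    define B' where "B' = map (\<lambda>i. if A ! i \<in> S then B ! i else A ! i) [0..<d]"
    have ne: "A ! i \<noteq> B ! j" if "i < d" "j < d" for i j
      using disj A B that unfolding seqs_def by (metis (mono_tags, lifting) disjoint_iff mem_Collect_eq nth_mem)
    have eq: "A ! i = A ! j \<longleftrightarrow> i = j" "B ! i = B ! j \<longleftrightarrow> i = j" if "i < d" "j < d" for i j
      using A B that by (auto simp: seqs_def nth_eq_iff_index_eq)
    have rng: "A ! i \<in> {1..n}" "B ! i \<in> {1..n}" if "i < d" for i
      using A B that by (auto dest: seqs_nth)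
    have "distinct A'" "distinct B'"
      unfolding A'_def B'_def using ne eq
      by (auto simp: distinct_map inj_on_def split: if_splits) metis+
    moreover have "set A' \<subseteq> {1..n}" "set B' \<subseteq> {1..n}"
      unfolding A'_def B'_def using rng by (auto split: if_splits)
    moreover have "set A' \<subseteq> S" "set B' \<inter> S = {}"
      unfolding A'_def B'_def using False by (auto split: if_splits)
    moreover have "length A' = d" "length B' = d" by (simp_all add: A'_def B'_def)
    ultimately have "pos A' B' S"
      using S unfolding pos_def seqs_def by blast
    then have "F A' B' S = c" by (rule c)
    moreover have factor: "chi_pair A B x = chi_pair A B (indicator S) * chi_pair A' B' x" for x
      unfolding chi_pair_def using A B False
      by (auto simp: prod.distrib[symmetric] A'_def B'_def seqs_def indicator_def intro!: prod.cong)
    have "F A B S = chi_pair A B (indicator S) * F A' B' S"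
      unfolding F_def sum_distrib_left
    proof (rule sum.cong[OF refl])
      fix T
      show "\<phi> (card (S \<inter> T)) * chi_pair A B (indicator T) =
          chi_pair A B (indicator S) * (\<phi> (card (S \<inter> T)) * chi_pair A' B' (indicator T))"
        by (subst factor[of "indicator T"]) (rule mult.left_commute)
    qed
    ultimately show ?thesis by simp
  qed
  then show thesis using that unfolding F_def by blast
qed

text \<open>All summands \<open>chi_pair A B\<close> of \<open>chi_top n B\<close> share the factor
  belonging to length \<open>d\<close>, so it passes to their sum and is the same for all
  \<open>B\<close> in \<open>top_sets n d\<close>.\<close>

lemma chi_top_eigenvector:
  fixes M :: "nat set \<Rightarrow> nat set \<Rightarrow> real"
  assumes "bose_mesner n k M"
  obtains ev where "\<And>B. B \<in> top_sets n d \<Longrightarrow>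
    mat_apply n k M (slice_restrict n k (chi_top n B)) =
      fun_scale ev (slice_restrict n k (chi_top n B))"
proof -
  obtain \<phi> :: "nat \<Rightarrow> real"
    where \<phi>: "\<And>S T. S \<in> slice n k \<Longrightarrow> T \<in> slice n k \<Longrightarrow> M S T = \<phi> (card (S \<inter> T))"
    using assms by (auto simp: bose_mesner_def)
  obtain c where c: "\<And>A B S. A \<in> seqs n d \<Longrightarrow> B \<in> seqs n d \<Longrightarrow> set A \<inter> set B = {} \<Longrightarrow> S \<in> slice n k \<Longrightarrow>
    (\<Sum>T\<in>slice n k. \<phi> (card (S \<inter> T)) * chi_pair A B (indicator T)) = c * chi_pair A B (indicator S)"
    by (rule chi_pair_eigenvector[of n d k \<phi>]) blast
  have "mat_apply n k M (slice_restrict n k (chi_top n B)) =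
      fun_scale c (slice_restrict n k (chi_top n B))" if "B \<in> top_sets n d" for B
  proof
    fix S
    have B: "B \<in> seqs n d" "length B = d" using that by (auto simp: top_sets_def seqs_def)
    show "mat_apply n k M (slice_restrict n k (chi_top n B)) S =
        fun_scale c (slice_restrict n k (chi_top n B)) S"
    proof (cases "S \<in> slice n k")
      case True
      let ?As = "{A \<in> seqs n d. seq_less A B}"
      have "mat_apply n k M (slice_restrict n k (chi_top n B)) S =
          (\<Sum>T\<in>slice n k. \<Sum>A\<in>?As. \<phi> (card (S \<inter> T)) * chi_pair A B (indicator T))"
        using True B by (simp add: mat_apply_def slice_restrict_def chi_top_def \<phi> sum_distrib_left)
      also have "\<dots> = (\<Sum>A\<in>?As. \<Sum>T\<in>slice n k. \<phi> (card (S \<inter> T)) * chi_pair A B (indicator T))"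
        by (rule sum.swap)
      also have "\<dots> = (\<Sum>A\<in>?As. c * chi_pair A B (indicator S))"
        using B True by (intro sum.cong) (auto simp: c seq_less_def)
      finally show ?thesis
        using True B by (simp add: fun_scale_def slice_restrict_def chi_top_def sum_distrib_left)
    qed (simp add: mat_apply_def fun_scale_def slice_restrict_def)
  qed
  then show thesis by (rule that)
qed

section \<open>Linear independence\<close>

lemma finite_seqs: "finite (seqs n d)"
  unfolding seqs_def by (rule finite_subset[OF _ finite_lists_length_eq[of "{1..n}" d]]) auto

lemma finite_top_sets: "finite (top_sets n d)"
  unfolding top_sets_def using finite_seqs by simp

text \<open>The pairs \<open>A ! i\<close>, \<open>B ! i\<close> are disjoint, so a set meeting all
  of them has at least as many elements as there are pairs. In case of equality it picks exactly one
  element from each, and every pick of \<open>A ! i\<close> instead of \<open>B ! i\<close> lowers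
  the sum.\<close>

lemma sum_set_transversal_less:
  fixes A B :: "nat list"
  assumes len: "length A = length B" and dA: "distinct A" and dB: "distinct B"
    and less: "seq_less A B" and E: "finite E"
    and hit: "\<And>i. i < length B \<Longrightarrow> A ! i \<in> E \<or> B ! i \<in> E"
  shows "length B \<le> card E"
    and "card E = length B \<Longrightarrow> E \<noteq> set B \<Longrightarrow> \<Sum>E < \<Sum>(set B)"
proof -
  \<comment> \<open>A choice of one element of \<open>E\<close> in each pair that prefers
    \<open>B ! i\<close>. Thus \<open>e i\<close> never exceeds \<open>B ! i\<close>, and it is
    smaller wherever \<open>B ! i\<close> is missing from \<open>E\<close>.\<close>
  define e where "e i = (if B ! i \<in> E then B ! i else A ! i)" for i
  let ?D = "{..<length B}"
  have ne: "A ! i \<noteq> B ! j" if "i < length B" "j < length B" for i j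
    using less len that unfolding seq_less_def by (metis disjoint_iff nth_mem)
  have inj: "inj_on e ?D"
    using ne len dA dB
    by (intro inj_onI) (auto simp: e_def nth_eq_iff_index_eq split: if_splits dest: sym)
  have sub: "e ` ?D \<subseteq> E" using hit by (auto simp: e_def)
  have card_e: "card (e ` ?D) = length B" using card_image[OF inj] by simp
  show "length B \<le> card E" using card_mono[OF E sub] card_e by simp
  assume card_E: "card E = length B" and "E \<noteq> set B"
  have E_eq: "E = e ` ?D" using card_subset_eq[OF E sub] card_e card_E by simp
  have "\<not> set B \<subseteq> E"
    using \<open>E \<noteq> set B\<close> card_subset_eq[OF E, of "set B"] card_E distinct_card[OF dB] by auto
  then obtain i where i: "i < length B" "B ! i \<notin> E" by (auto simp: set_conv_nth)
  have lt: "A ! j < B ! j" if "j < length B" for j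
    using less that by (auto simp: seq_less_def list_all2_conv_all_nth)
  have "\<Sum>E = sum e ?D" unfolding E_eq using sum.reindex[OF inj, of id] by simp
  also have "\<dots> < (\<Sum>i\<in>?D. B ! i)"
    using i lt by (intro sum_strict_mono_ex1) (auto simp: e_def less_imp_le intro!: bexI[of _ i])
  also have "\<dots> = \<Sum>(set B)"
    using distinct_sum_list_conv_Sum[OF dB] by (simp add: sum_list_sum_nth atLeast0LessThan)
  finally show "\<Sum>E < \<Sum>(set B)" .
qed

text \<open>For finite \<open>E\<close> this is the inner product on the slice of \<open>f\<close>
  with the monomial that multiplies the variables indexed by \<open>E\<close>.\<close>

definition superset_sum :: "nat \<Rightarrow> nat \<Rightarrow> nat set \<Rightarrow> (nat set \<Rightarrow> real) \<Rightarrow> real" where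
  "superset_sum n k E f = (\<Sum>T\<in>slice n k. of_bool (E \<subseteq> T) * f T)"

lemma superset_sum_chi_top:
  assumes "B \<in> top_sets n d"
  shows "superset_sum n k E (slice_restrict n k (chi_top n B)) =
    (\<Sum>A\<in>{A \<in> seqs n d. seq_less A B}. \<Sum>T\<in>slice n k. of_bool (E \<subseteq> T) * chi_pair A B (indicator T))"
proof -
  have "length B = d" using assms by (auto simp: top_sets_def seqs_def)
  then show ?thesis
    unfolding superset_sum_def slice_restrict_def chi_top_def
    by (subst sum.swap) (simp add: sum_distrib_left)
qed

text \<open>The off-diagonal zeros of the triangular system. By the bounds on transversals,
  \<open>E\<close> misses some pair \<open>A ! i\<close>, \<open>B ! i\<close> entirely, for every
  \<open>A\<close> below \<open>B\<close>. Transposing this pair preserves the condition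
  \<open>E \<subseteq> T\<close>, so the contribution of \<open>A\<close> cancels.\<close>

lemma superset_sum_chi_top_eq_0:
  assumes B: "B \<in> top_sets n d" and E: "finite E"
    and cases: "card E < d \<or> card E = d \<and> E \<noteq> set B \<and> \<Sum>(set B) \<le> \<Sum>E"
  shows "superset_sum n k E (slice_restrict n k (chi_top n B)) = 0"
  unfolding superset_sum_chi_top[OF B]
proof (rule sum.neutral, safe)
  fix A assume A: "A \<in> seqs n d" and less: "seq_less A B"
  have B': "B \<in> seqs n d" using B by (simp add: top_sets_def)
  have "\<exists>i<d. A ! i \<notin> E \<and> B ! i \<notin> E"
  proof (rule ccontr)
    assume "\<not> ?thesis"
    then have hit: "A ! i \<in> E \<or> B ! i \<in> E" if "i < length B" for i
      using that B' by (auto simp: seqs_def)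
    have "length A = length B" "distinct A" "distinct B" "length B = d"
      using A B' by (auto simp: seqs_def)
    with sum_set_transversal_less[OF _ _ _ less E hit] cases show False by fastforce
  qed
  then obtain i where i: "i < d" "A ! i \<notin> E" "B ! i \<notin> E" by blast
  let ?t = "transpose (A ! i) (B ! i)"
  have "?t ` E = E" using i by (auto simp: transpose_image_eq)
  then have "E \<subseteq> ?t ` T \<longleftrightarrow> E \<subseteq> T" for T
    by (metis inj_image_subset_iff inj_transpose)
  moreover have "set A \<inter> set B = {}" using less by (simp add: seq_less_def)
  ultimately show "(\<Sum>T\<in>slice n k. of_bool (E \<subseteq> T) * chi_pair A B (indicator T)) = 0"
    by (intro sum_chi_pair_eq_0[OF A B' _ i(1)]) simp_all
qed

text \<open>The diagonal entries. For \<open>T\<close> containing \<open>B\<close>,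
  \<open>chi_pair A B\<close> vanishes unless \<open>T\<close> avoids \<open>A\<close>, and then
  equals \<open>(-1) ^ d\<close>. All nonzero terms have the same sign, so it suffices to exhibit
  one of them.\<close>

lemma superset_sum_chi_top_neq_0:
  assumes B: "B \<in> top_sets n d" and d: "d \<le> k" and k: "2 * k \<le> n"
  shows "superset_sum n k (set B) (slice_restrict n k (chi_top n B)) \<noteq> 0"
proof -
  let ?As = "{A \<in> seqs n d. seq_less A B}"
  let ?P = "\<lambda>A T. of_bool (set B \<subseteq> T \<and> set A \<inter> T = {}) :: real"
  have B': "B \<in> seqs n d" "length B = d" using B by (auto simp: top_sets_def seqs_def)
  have "of_bool (set B \<subseteq> T) * chi_pair A B (indicator T) = (-1) ^ d * ?P A T" if "A \<in> ?As" for A T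
  proof (cases "set B \<subseteq> T \<and> set A \<inter> T = {}")
    case True
    have "indicator T (A ! i) - indicator T (B ! i) = (-1 :: real)" if "i < d" for i
    proof -
      have "A ! i \<in> set A" "B ! i \<in> set B" using that \<open>A \<in> ?As\<close> B' by (auto simp: seqs_def)
      then show ?thesis using True by (auto simp: indicator_def)
    qed
    then show ?thesis using True B' by (simp add: chi_pair_def)
  next
    case False
    have "chi_pair A B (indicator T) = 0" if sub: "set B \<subseteq> T"
    proof -
      obtain i where i: "i < d" "A ! i \<in> T"
        using False sub \<open>A \<in> ?As\<close> by (fastforce simp: seqs_def in_set_conv_nth[of _ A])
      then have "B ! i \<in> T" using sub B' by auto
      then show ?thesis
        unfolding chi_pair_def using i B' by (intro prod_zero) (auto intro!: bexI[of _ i])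
    qed
    then show ?thesis using False by auto
  qed
  then have eq: "superset_sum n k (set B) (slice_restrict n k (chi_top n B)) =
      (-1) ^ d * (\<Sum>A\<in>?As. \<Sum>T\<in>slice n k. ?P A T)"
    unfolding superset_sum_chi_top[OF B] by (simp add: sum_distrib_left)
  obtain A where A: "A \<in> ?As" using B by (auto simp: top_sets_def)
  have "card (set A) = d" "card (set B) = d" "set A \<subseteq> {1..n}" "set B \<subseteq> {1..n} - set A"
    using A B' by (auto simp: seqs_def distinct_card seq_less_def)
  \<comment> \<open>There is room for \<open>T\<close> outside \<open>A\<close>, because
    \<open>n - d \<ge> n - k \<ge> k\<close>.\<close>
  moreover from this have "k \<le> card ({1..n} - set A)" using d k by (simp add: card_Diff_subset)
  ultimately obtain T where T: "set B \<subseteq> T" "T \<subseteq> {1..n} - set A" "card T = k"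
    using exists_subset_between[of "set B" k "{1..n} - set A"] d by auto
  have "(\<Sum>T\<in>slice n k. ?P A T) > 0"
    using T by (intro sum_pos2[OF finite_slice, of T]) (auto simp: slice_def)
  then have "(\<Sum>A\<in>?As. \<Sum>T\<in>slice n k. ?P A T) > 0"
    using A finite_seqs by (intro sum_pos2[of _ A]) (auto intro!: sum_nonneg)
  then show ?thesis unfolding eq by simp
qed

lemma sum_fun_scale_apply:
  "(\<Sum>i\<in>I. fun_scale (c i) (g i)) S = (\<Sum>i\<in>I. c i * g i S)"
  by (induction I rule: infinite_finite_induct) (auto simp: fun_scale_def)

lemma superset_sum_linear:
  "superset_sum n k E (\<Sum>i\<in>I. fun_scale (c i) (g i)) = (\<Sum>i\<in>I. c i * superset_sum n k E (g i))"
  unfolding superset_sum_def sum_fun_scale_apply sum_distrib_left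
  by (subst sum.swap) (simp add: mult.left_commute)

lemma mat_apply_linear:
  "mat_apply n k M (\<Sum>i\<in>I. fun_scale (c i) (g i)) = (\<Sum>i\<in>I. fun_scale (c i) (mat_apply n k M (g i)))"
proof
  fix S
  show "mat_apply n k M (\<Sum>i\<in>I. fun_scale (c i) (g i)) S =
      (\<Sum>i\<in>I. fun_scale (c i) (mat_apply n k M (g i))) S"
    unfolding mat_apply_def sum_fun_scale_apply sum_distrib_left
    by (subst sum.swap) (simp add: mult.left_commute sum_distrib_left)
qed

text \<open>The functionals \<open>superset_sum n k (set B)\<close> are triangular with respect to the functions
  \<open>\<chi>\<^sub>B\<close>, ordered first by increasing length of \<open>B\<close> and then by decreasing sum of its elements.\<close>

lemma chi_top_coeffs_eq_0:
  assumes k: "2 * k \<le> n"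
    and zero: "(\<Sum>B\<in>(\<Union>d\<le>k. top_sets n d). fun_scale (c B) (slice_restrict n k (chi_top n B))) = 0"
  shows "\<forall>B\<in>(\<Union>d\<le>k. top_sets n d). c B = 0"
proof (rule ccontr)
  let ?I = "\<Union>d\<le>k. top_sets n d"
  let ?L = "\<lambda>E B. superset_sum n k E (slice_restrict n k (chi_top n B))"
  assume "\<not> (\<forall>B\<in>?I. c B = 0)"
  define N where "N = {B \<in> ?I. c B \<noteq> 0}"
  have N: "finite N" "N \<noteq> {}"
    using \<open>\<not> _\<close> unfolding N_def by (auto simp: finite_top_sets)
  \<comment> \<open>The first top set with nonzero coefficient in the triangular order is chosen:
    least length \<open>d\<close>, and among those of length \<open>d\<close> the greatest element
    sum \<open>s\<close>.\<close>
  define d where "d = Min (length ` N)"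
  have d_le: "d \<le> length B" if "B \<in> N" for B using that N by (simp add: d_def)
  define N' where "N' = {B \<in> N. length B = d}"
  have "d \<in> length ` N" unfolding d_def using N by (intro Min_in) auto
  then have N': "finite N'" "N' \<noteq> {}" using N by (auto simp: N'_def)
  define s where "s = Max ((\<lambda>B. \<Sum>(set B)) ` N')"
  have le_s: "\<Sum>(set B) \<le> s" if "B \<in> N'" for B using that N' by (simp add: s_def)
  have "s \<in> (\<lambda>B. \<Sum>(set B)) ` N'" unfolding s_def using N' by (intro Max_in) auto
  then obtain B where B: "B \<in> N'" "\<Sum>(set B) = s" by auto
  have lenI: "length X \<le> k \<and> X \<in> top_sets n (length X) \<and> sorted_wrt (<) X \<and> distinct X"
    if "X \<in> ?I" for X
    using that by (auto simp: top_sets_def seqs_def)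
  have BI: "B \<in> ?I" "length B = d" "c B \<noteq> 0" using B by (auto simp: N'_def N_def)
  have "c X * ?L (set B) X = 0" if X: "X \<in> ?I - {B}" for X
  proof (cases "c X = 0")
    case False
    then have "X \<in> N" using X by (auto simp: N_def)
    have card_B: "card (set B) = d" using BI lenI by (metis distinct_card)
    \<comment> \<open>Strictly increasing lists are determined by their sets. This settles ties: a
      different top set of the same length and sum is annihilated as well.\<close>
    have "set B \<noteq> set X"
      using X BI lenI by (metis DiffE insertI1 strict_sorted_equal)
    moreover have "d < length X \<or> length X = d \<and> \<Sum>(set X) \<le> \<Sum>(set B)"
      using d_le[OF \<open>X \<in> N\<close>] le_s[of X] B(2) \<open>X \<in> N\<close> by (auto simp: N'_def)
    ultimately have "?L (set B) X = 0"
      using X lenI[of X] card_B by (intro superset_sum_chi_top_eq_0[where d = "length X"]) auto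
    then show ?thesis by simp
  qed simp
  moreover have "(\<Sum>X\<in>?I. c X * ?L (set B) X) = 0"
    using superset_sum_linear[of n k "set B" c "\<lambda>B. slice_restrict n k (chi_top n B)" ?I, symmetric]
    unfolding zero by (simp add: superset_sum_def)
  ultimately have "c B * ?L (set B) B = 0"
    using BI finite_top_sets by (subst (asm) sum.remove[of _ B]) (auto simp: sum.neutral)
  then show False
    using superset_sum_chi_top_neq_0[of B n d k] BI lenI[of B] k by auto
qed

section \<open>Counting top sets\<close>

text \<open>Lets the witness \<open>A\<close> of a top set follow \<open>B\<close> when the ground
  set shrinks from \<open>{1..Suc n}\<close> to \<open>{1..n}\<close>.\<close>

lemma seq_less_upper_bound:
  assumes "seq_less A B" "set B \<subseteq> {..n}"
  shows "set A \<subseteq> {..n}"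
proof
  fix a assume "a \<in> set A"
  then obtain i where "i < length B" "a < B ! i"
    using assms(1) by (auto simp: seq_less_def list_all2_conv_all_nth in_set_conv_nth)
  then show "a \<in> {..n}" using assms(2) nth_mem[of i B] by fastforce
qed

lemma seqs_restrict: "A \<in> seqs m d \<Longrightarrow> set A \<subseteq> {..n} \<Longrightarrow> A \<in> seqs n d"
  by (auto simp: seqs_def subset_eq)

lemma top_sets_0: "top_sets n 0 = {[]}"
  by (auto simp: top_sets_def seqs_def seq_less_def)

text \<open>A top set and its witness together occupy \<open>2 * d\<close> different elements of
  \<open>{1..n}\<close>.\<close>

lemma top_sets_eq_empty:
  assumes "n < 2 * d"
  shows "top_sets n d = {}"
proof (rule ccontr)
  assume "top_sets n d \<noteq> {}"
  then obtain A B where AB: "A \<in> seqs n d" "B \<in> seqs n d" "seq_less A B"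
    by (auto simp: top_sets_def)
  then have "2 * d = card (set A \<union> set B)"
    by (subst card_Un_disjoint) (auto simp: seq_less_def seqs_def distinct_card)
  also have "\<dots> \<le> card {1..n}" using AB by (intro card_mono) (auto simp: seqs_def)
  finally show False using assms by simp
qed

text \<open>The ballot recursion: split by whether \<open>Suc n\<close> occurs in \<open>B\<close>.
  If it does, it is the last entry, and deleting it together with its partner leaves a top set over
  \<open>{1..n}\<close>.\<close>

lemma top_sets_Suc_Suc:
  assumes "2 * Suc d \<le> Suc n"
  shows "top_sets (Suc n) (Suc d) = top_sets n (Suc d) \<union> (\<lambda>B. B @ [Suc n]) ` top_sets n d"
    (is "?l = ?r")
proof
  show "?l \<subseteq> ?r"
  proof
    fix B assume "B \<in> ?l"
    then obtain A where A: "A \<in> seqs (Suc n) (Suc d)" and less: "seq_less A B"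
      and B: "B \<in> seqs (Suc n) (Suc d)" and sorted: "sorted_wrt (<) B"
      by (auto simp: top_sets_def)
    show "B \<in> ?r"
    proof (cases "Suc n \<in> set B")
      case False
      then have sB: "set B \<subseteq> {..n}" using B by (fastforce simp: seqs_def le_Suc_eq)
      note sA = seq_less_upper_bound[OF less sB]
      have "A \<in> seqs n (Suc d)" "B \<in> seqs n (Suc d)"
        using A B sA sB by (auto intro: seqs_restrict)
      then show ?thesis using less sorted by (auto simp: top_sets_def)
    next
      case True
      obtain B' b where B': "B = B' @ [b]" using B by (cases B rule: rev_cases) (auto simp: seqs_def)
      obtain A' a where A': "A = A' @ [a]" using A by (cases A rule: rev_cases) (auto simp: seqs_def)
      have b: "b = Suc n" and sB: "set B' \<subseteq> {..n}"
        using B sorted True unfolding B' by (fastforce simp: seqs_def sorted_wrt_append)+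
      have less': "seq_less A' B'" 
        using less A B unfolding A' B' by (auto simp: seq_less_def seqs_def list_all2_append)
      note sA = seq_less_upper_bound[OF less' sB]
      have "A' \<in> seqs (Suc n) d" "B' \<in> seqs (Suc n) d"
        using A B unfolding A' B' by (auto simp: seqs_def)
      then have "A' \<in> seqs n d" "B' \<in> seqs n d"
        using sA sB by (auto intro: seqs_restrict)
      then have "B' \<in> top_sets n d"
        using less' sorted unfolding B' by (auto simp: top_sets_def sorted_wrt_append)
      then show ?thesis using B' b by blast
    qed
  qed
  have "seqs n (Suc d) \<subseteq> seqs (Suc n) (Suc d)" by (fastforce simp: seqs_def)
  then have "top_sets n (Suc d) \<subseteq> ?l" by (auto simp: top_sets_def)
  moreover have "B @ [Suc n] \<in> ?l" if "B \<in> top_sets n d" for B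
  proof -
    obtain A where A: "A \<in> seqs n d" and less: "seq_less A B"
      and B: "B \<in> seqs n d" and sorted: "sorted_wrt (<) B"
      using \<open>B \<in> _\<close> by (auto simp: top_sets_def)
    have "card (set A \<union> set B) \<le> 2 * d"
      using A B card_Un_le[of "set A" "set B"] by (auto simp: seqs_def distinct_card)
    \<comment> \<open>The length bound gives \<open>2 * d < n\<close>, so some element is free to be
      the partner of the new entry \<open>Suc n\<close>.\<close>
    then have "\<not> {1..n} \<subseteq> set A \<union> set B"
      using assms card_mono[of "set A \<union> set B" "{1..n}"] by auto
    then obtain a where a: "a \<in> {1..n}" "a \<notin> set A" "a \<notin> set B" by blast
    have "A @ [a] \<in> seqs (Suc n) (Suc d)" "B @ [Suc n] \<in> seqs (Suc n) (Suc d)"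
      using A B a by (fastforce simp: seqs_def)+
    moreover have "seq_less (A @ [a]) (B @ [Suc n])"
      using less a A B by (fastforce simp: seq_less_def seqs_def list_all2_appendI)
    moreover have "sorted_wrt (<) (B @ [Suc n])"
      using sorted B by (fastforce simp: sorted_wrt_append seqs_def)
    ultimately show ?thesis by (auto simp: top_sets_def)
  qed
  ultimately show "?r \<subseteq> ?l" by blast
qed

lemma card_top_sets_Suc_Suc:
  assumes "2 * Suc d \<le> Suc n"
  shows "card (top_sets (Suc n) (Suc d)) = card (top_sets n (Suc d)) + card (top_sets n d)"
proof -
  have "top_sets n (Suc d) \<inter> (\<lambda>B. B @ [Suc n]) ` top_sets n d = {}"
    by (auto simp: top_sets_def seqs_def)
  then show ?thesis
    unfolding top_sets_Suc_Suc[OF assms]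
    by (simp add: card_Un_disjoint finite_top_sets card_image inj_on_def)
qed

text \<open>The ballot recursion summed over all lengths is Pascal's rule. Only the largest
  admissible \<open>k\<close> for odd \<open>n\<close> on the smaller ground set falls outside the
  induction hypothesis.\<close>

lemma sum_card_top_sets:
  "2 * k \<le> n \<Longrightarrow> (\<Sum>d\<le>k. card (top_sets n d)) = n choose k"
proof (induction n arbitrary: k)
  case 0
  then show ?case by (simp add: top_sets_0)
next
  case (Suc n)
  show ?case
  proof (cases k)
    case 0
    then show ?thesis by (simp add: top_sets_0)
  next
    case (Suc j)
    have "(\<Sum>d\<le>k. card (top_sets (Suc n) d)) = 1 + (\<Sum>d\<le>j. card (top_sets (Suc n) (Suc d)))"
      unfolding Suc by (subst sum.atMost_Suc_shift) (simp add: top_sets_0)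
    also have "(\<Sum>d\<le>j. card (top_sets (Suc n) (Suc d))) =
        (\<Sum>d\<le>j. card (top_sets n (Suc d)) + card (top_sets n d))"
      using Suc.prems \<open>k = Suc j\<close> by (intro sum.cong) (auto intro!: card_top_sets_Suc_Suc)
    \<comment> \<open>The leading 1, which counted the empty top set over \<open>{1..Suc n}\<close>,
      is reused as the term of length 0 over \<open>{1..n}\<close>.\<close>
    also have "1 + \<dots> = (\<Sum>d\<le>Suc j. card (top_sets n d)) + (\<Sum>d\<le>j. card (top_sets n d))"
      by (subst sum.atMost_Suc_shift) (simp add: top_sets_0 sum.distrib)
    also have "(\<Sum>d\<le>j. card (top_sets n d)) = n choose j"
      using Suc.IH[of j] Suc.prems \<open>k = Suc j\<close> by simp
    also have "(\<Sum>d\<le>Suc j. card (top_sets n d)) = n choose Suc j"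
    proof (cases "2 * Suc j \<le> n")
      case True
      then show ?thesis using Suc.IH[of "Suc j"] by simp
    next
      case False
      \<comment> \<open>In this boundary case no top set has length \<open>Suc j\<close>, so the sum
        stops at \<open>j\<close>. The two middle binomial coefficients of an odd row agree.\<close>
      then have n: "n = Suc (2 * j)" using Suc.prems \<open>k = Suc j\<close> by simp
      then have "n choose Suc j = n choose j"
        using binomial_symmetric[of "Suc j" n] by simp
      then show ?thesis
        using Suc.IH[of j] False n by (simp add: top_sets_eq_empty)
    qed
    finally show ?thesis using \<open>k = Suc j\<close> by simp
  qed
qed

section \<open>Eigenspaces\<close>

text \<open>The hypothesis concerns coefficients attached to indices, so it also excludes
  repetitions: \<open>g a = g b\<close> would give a relation with coefficients 1 and -1.
  Injectivity is what allows the functions to be counted by their indices.\<close>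

lemma independent_family:
  assumes fin: "finite I"
    and coeffs: "\<And>c. (\<Sum>i\<in>I. fun_scale (c i) (g i)) = 0 \<Longrightarrow> \<forall>i\<in>I. c i = 0"
  shows "inj_on g I" and "fun_vs.independent (g ` I)"
proof -
  show inj: "inj_on g I"
  proof (rule inj_onI, rule ccontr)
    fix a b assume ab: "a \<in> I" "b \<in> I" "g a = g b" "a \<noteq> b"
    let ?c = "\<lambda>i. of_bool (i = a) - of_bool (i = b) :: real"
    have "(\<Sum>i\<in>I. fun_scale (?c i) (g i)) =
        (\<Sum>i\<in>I. if i = a then g i else 0) - (\<Sum>i\<in>I. if i = b then g i else 0)"
      unfolding sum_subtractf[symmetric]
      by (intro sum.cong) (auto simp: fun_vs.scale_left_diff_distrib)
    also have "\<dots> = 0" using ab fin by simp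
    finally show False using coeffs[of ?c] ab by auto
  qed
  show "fun_vs.independent (g ` I)"
  proof (rule fun_vs.independent_if_scalars_zero)
    fix f x assume "(\<Sum>x\<in>g ` I. fun_scale (f x) x) = 0" "x \<in> g ` I"
    then show "f x = 0" using coeffs[of "f \<circ> g"] by (auto simp: sum.reindex[OF inj])
  qed (use fin in simp)
qed

lemma span_image_coeffs:
  assumes "finite J" "inj_on g J" "f \<in> fun_vs.span (g ` J)"
  obtains c where "f = (\<Sum>j\<in>J. fun_scale (c j) (g j))"
proof -
  obtain u where "f = (\<Sum>v\<in>g ` J. fun_scale (u v) v)"
    using assms by (auto simp: fun_vs.span_finite)
  then show thesis using that[of "u \<circ> g"] by (simp add: sum.reindex[OF assms(2)])
qed

text \<open>The point indicators span the functions on the slice, which bounds the size of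
  independent sets by \<open>n choose k\<close>. A function outside the span of \<open>X\<close>
  would extend \<open>X\<close> beyond this bound.\<close>

lemma slice_functions_subset_span:
  assumes X: "X \<subseteq> slice_functions n k" "finite X" "fun_vs.independent X" "card X = n choose k"
  shows "slice_functions n k \<subseteq> fun_vs.span X"
proof
  fix f assume f: "f \<in> slice_functions n k"
  let ?D = "(\<lambda>S. indicator {S} :: nat set \<Rightarrow> real) ` slice n k"
  have in_span: "h \<in> fun_vs.span ?D" if "h \<in> slice_functions n k" for h
  proof -
    have "h = (\<Sum>S\<in>slice n k. fun_scale (h S) (indicator {S}))"
    proof
      fix T
      have "(\<Sum>S\<in>slice n k. h S * indicator {S} T) = (\<Sum>S\<in>slice n k. if S = T then h S else 0)"
        by (intro sum.cong) (auto simp: indicator_def)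
      then show "h T = (\<Sum>S\<in>slice n k. fun_scale (h S) (indicator {S})) T"
        using that finite_slice[of n k] by (auto simp: sum_fun_scale_apply slice_functions_def)
    qed
    moreover have "(\<Sum>S\<in>slice n k. fun_scale (h S) (indicator {S})) \<in> fun_vs.span ?D"
      by (intro fun_vs.span_sum fun_vs.span_scale fun_vs.span_base) simp
    ultimately show ?thesis by simp
  qed
  have card_D: "card ?D \<le> n choose k"
    using card_image_le[OF finite_slice, of "\<lambda>S. indicator {S}" n k] n_subsets[of "{1..n}" k]
    by (simp add: slice_def)
  show "f \<in> fun_vs.span X"
  proof (rule ccontr)
    assume nin: "f \<notin> fun_vs.span X"
    then have "fun_vs.independent (insert f X)" using X(3) by (rule fun_vs.independent_insertI)
    then have "card (insert f X) \<le> card ?D"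
      using fun_vs.independent_span_bound[of ?D "insert f X"] in_span f X(1) finite_slice by blast
    moreover have "f \<notin> X" using nin fun_vs.span_base by blast
    ultimately show False using X card_D by simp
  qed
qed

text \<open>Different lengths may share an eigenvalue, so the bases of all lengths \<open>d\<close>
  with \<open>ev d = \<mu>\<close> are joined. If \<open>\<mu>\<close> is none of these values, the
  union is empty and both sides are the zero space.\<close>

theorem lemma4p3:
  fixes n k :: nat and M :: "nat set \<Rightarrow> nat set \<Rightarrow> real"
  assumes "2 * k \<le> n" and "bose_mesner n k M"
  shows "(\<forall>d\<le>k. fun_vs.independent (Y_basis n k d)) \<and>
    (\<exists>ev :: nat \<Rightarrow> real. \<forall>\<mu>.
       eigenspace n k M \<mu> = fun_vs.span (\<Union>d\<in>{d. d \<le> k \<and> ev d = \<mu>}. Y_basis n k d))"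
proof -
  define g where "g B = slice_restrict n k (chi_top n B)" for B
  define I where "I = (\<Union>d\<le>k. top_sets n d)"
  have finI: "finite I" by (simp add: I_def finite_top_sets)
  have coeffs: "\<forall>B\<in>I. c B = 0" if "(\<Sum>B\<in>I. fun_scale (c B) (g B)) = 0" for c
    using chi_top_coeffs_eq_0[OF assms(1)] that unfolding I_def g_def by blast
  have inj: "inj_on g I" and indep: "fun_vs.independent (g ` I)"
    using independent_family[OF finI, of g] coeffs by blast+
  have Y: "Y_basis n k d = g ` top_sets n d" for d by (simp add: Y_basis_def g_def)
  have "card I = (\<Sum>d\<le>k. card (top_sets n d))"
    unfolding I_def
    by (rule card_UN_disjoint) (auto simp: finite_top_sets, auto simp: top_sets_def seqs_def)
  then have "card (g ` I) = n choose k"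
    by (simp add: card_image[OF inj] sum_card_top_sets[OF assms(1)])
  then have span: "slice_functions n k \<subseteq> fun_vs.span (g ` I)"
    using finI indep
    by (intro slice_functions_subset_span) (auto simp: g_def slice_functions_def slice_restrict_def)
  have "\<exists>c. \<forall>B\<in>top_sets n d. mat_apply n k M (g B) = fun_scale c (g B)" for d
    unfolding g_def by (rule chi_top_eigenvector[OF assms(2), of d]) blast
  then obtain ev where ev: "\<And>d B. B \<in> top_sets n d \<Longrightarrow> mat_apply n k M (g B) = fun_scale (ev d) (g B)"
    by metis
  have ev': "mat_apply n k M (g B) = fun_scale (ev (length B)) (g B)" if "B \<in> I" for B
    using that ev by (auto simp: I_def top_sets_def seqs_def)
  have apply_sum: "mat_apply n k M (\<Sum>B\<in>J. fun_scale (c B) (g B)) =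
      (\<Sum>B\<in>J. fun_scale (c B * ev (length B)) (g B))" if "J \<subseteq> I" for J c
    unfolding mat_apply_linear using that by (intro sum.cong) (auto simp: ev')
  have "eigenspace n k M \<mu> = fun_vs.span (\<Union>d\<in>{d. d \<le> k \<and> ev d = \<mu>}. Y_basis n k d)" for \<mu>
  proof -
    define J where "J = {B \<in> I. ev (length B) = \<mu>}"
    have J: "J \<subseteq> I" "finite J" using finI by (auto simp: J_def)
    have len: "length B = d" if "B \<in> top_sets n d" for B d
      using that by (simp add: top_sets_def seqs_def)
    have Y_eq: "(\<Union>d\<in>{d. d \<le> k \<and> ev d = \<mu>}. Y_basis n k d) = g ` J"
      unfolding Y J_def I_def by (auto simp: len)
    have "f \<in> fun_vs.span (g ` J)" if f: "f \<in> eigenspace n k M \<mu>" for f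
    proof -
      have "f \<in> fun_vs.span (g ` I)" using f span by (auto simp: eigenspace_def)
      then obtain c where c: "f = (\<Sum>B\<in>I. fun_scale (c B) (g B))"
        using span_image_coeffs[OF finI inj] by blast
      \<comment> \<open>Expand \<open>M f - \<mu> f = 0\<close> in the basis. By independence, only
        top sets whose eigenvalue is \<open>\<mu>\<close> can keep a nonzero coefficient in
        \<open>f\<close>.\<close>
      have "(\<Sum>B\<in>I. fun_scale (c B * (ev (length B) - \<mu>)) (g B)) =
          (\<Sum>B\<in>I. fun_scale (c B * ev (length B)) (g B)) - fun_scale \<mu> (\<Sum>B\<in>I. fun_scale (c B) (g B))"
        by (simp add: fun_vs.scale_sum_right sum_subtractf[symmetric] fun_vs.scale_left_diff_distrib
            algebra_simps)
      also have "\<dots> = 0"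
        using f apply_sum[of I c] c by (simp add: eigenspace_def)
      finally have "\<forall>B\<in>I. c B * (ev (length B) - \<mu>) = 0" by (rule coeffs)
      then have "f = (\<Sum>B\<in>J. fun_scale (c B) (g B))"
        unfolding c using finI by (intro sum.mono_neutral_right) (auto simp: J_def)
      then show ?thesis
        by (simp add: fun_vs.span_sum fun_vs.span_scale fun_vs.span_base)
    qed
    moreover have "f \<in> eigenspace n k M \<mu>" if f: "f \<in> fun_vs.span (g ` J)" for f
    proof -
      obtain c where c: "f = (\<Sum>B\<in>J. fun_scale (c B) (g B))"
        using span_image_coeffs[OF J(2) inj_on_subset[OF inj J(1)] f] by blast
      have "f S = 0" if "S \<notin> slice n k" for S
        unfolding c sum_fun_scale_apply using that by (simp add: g_def slice_restrict_def)
      moreover have "mat_apply n k M f = fun_scale \<mu> f"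
        unfolding c apply_sum[OF J(1)] fun_vs.scale_sum_right
        by (intro sum.cong) (auto simp: J_def mult.commute)
      ultimately show ?thesis by (simp add: eigenspace_def slice_functions_def)
    qed
    ultimately show ?thesis unfolding Y_eq by (intro subset_antisym subsetI)
  qed
  moreover have "fun_vs.independent (Y_basis n k d)" if "d \<le> k" for d
    unfolding Y using that by (intro fun_vs.independent_mono[OF indep]) (auto simp: I_def)
  ultimately show ?thesis by blast
qed

end
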